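(* For all integers $n,d$ with $0<d<n$, \[ N(n,d)\le L(n-1,d)+L(n-1,d-1). \]
   Context: Words are over the binary alphabet $\{0,1\}$ and are compared lexicographically with $0<1$. A necklace is the lexicographically smallest word in an equivalence class of words under rotation. A Lyndon word is a (non-empty) necklace that is strictly smaller than any of its non-trivial rotations (so every word of length 1 is a Lyndon word). The density of a binary word is the number of 1s it contains. For $n\ge 1$ and $0\le d\le n$, $N(n,d)$ denotes the number of binary necklaces of length $n$ and density $d$, and $L(n,d)$ denotes the number of binary Lyndon words of length $n$ and density $d$. *)

theory Defs
  imports Main "HOL-Library.List_Lexorder"
begin

text \<open>
  Binary words are lists of Booleans, with \<^term>\<open>False\<close> for 0 and \<^term>\<open>True\<close> for 1.
  The order on words is the lexicographic order of \<^theory>\<open>HOL-Library.List_Lexorder\<close>.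
\<close>

type_synonym word = "bool list"

definition rotation_rel :: "word rel" where
  "rotation_rel = {(v, w). \<exists>k. w = rotate k v}"

lemma equiv_rotation_rel: "equiv UNIV rotation_rel"
proof (rule equivI)
  show "rotation_rel \<subseteq> UNIV \<times> UNIV"
    by simp
  show "refl rotation_rel"
    unfolding refl_on_def rotation_rel_def
    by (auto intro!: exI[of _ 0])
  show "sym rotation_rel"
  proof (rule symI)
    fix v w
    assume "(v, w) \<in> rotation_rel"
    then obtain k where w: "w = rotate k v"
      by (auto simp: rotation_rel_def)
    show "(w, v) \<in> rotation_rel"
    proof (cases "v = []")
      case True
      then show ?thesis
        using w by (auto simp: rotation_rel_def)
    next
      case False
      then have "k * length v - k + k = k * length v"
        by (cases "length v") auto
      then have "v = rotate (k * length v - k) w"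
        unfolding w rotate_rotate by (simp add: rotate_id)
      then show ?thesis
        by (auto simp: rotation_rel_def)
    qed
  qed
  show "trans rotation_rel"
    unfolding trans_def rotation_rel_def
    by (auto simp: rotate_rotate)
qed

definition necklace :: "word \<Rightarrow> bool" where
  "necklace w \<longleftrightarrow> (\<exists>C \<in> UNIV // rotation_rel. w \<in> C \<and> (\<forall>v \<in> C. w \<le> v))"

text \<open>
  A non-trivial rotation is one by an amount strictly between 0 and the length; it may
  coincide with the word itself, and this is what excludes periodic words.
\<close>

definition lyndon :: "word \<Rightarrow> bool" where
  "lyndon w \<longleftrightarrow> w \<noteq> [] \<and> necklace w \<and> (\<forall>k. 0 < k \<and> k < length w \<longrightarrow> w < rotate k w)"

definition density :: "word \<Rightarrow> nat" where
  "density w = count_list w True"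

definition num_necklaces :: "nat \<Rightarrow> nat \<Rightarrow> nat" where
  "num_necklaces n d = card {w. length w = n \<and> density w = d \<and> necklace w}"

definition num_lyndon :: "nat \<Rightarrow> nat \<Rightarrow> nat" where
  "num_lyndon n d = card {w. length w = n \<and> density w = d \<and> lyndon w}"

end

theory Submission
  imports Defs "HOL-Library.Sublist"
begin

text \<open>
  A necklace \<open>w\<close> of density strictly between 0 and its length ends in 1, say \<open>w = a1\<close>.
  If \<open>a\<close> is Lyndon, send \<open>w\<close> to \<open>a\<close>. Otherwise \<open>a = t\<^sup>k t'\<close> with \<open>k \<ge> 1\<close>, \<open>t\<close> Lyndon and \<open>t'\<close> a
  nonempty prefix of \<open>t\<close>; write \<open>t' = z01\<^sup>c\<close> and send \<open>w = t\<^sup>k z01\<^sup>c1\<close> to \<open>t\<^sup>k 1\<^sup>c z1\<close>. This word is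
  Lyndon, and \<open>w\<close> can be recovered from it. If \<open>c = 0\<close>, replacing its last letter by 0 gives \<open>a\<close>. If \<open>c \<ge> 1\<close>, then \<open>t\<^sup>k 1\<^sup>c\<close> is the longest Lyndon
  prefix of \<open>t\<^sup>k 1\<^sup>c z\<close>, and \<open>c\<close> is determined because in \<open>t\<close> the block \<open>z01\<^sup>c\<close> is followed by 0, by
  the end of \<open>t\<close>, or by a single 1 that ends \<open>t\<close>. The two cases do not collide: if
  \<open>c \<ge> 1\<close>, then \<open>z01\<close> is a proper prefix of the Lyndon word \<open>u = t\<^sup>k 1\<^sup>c\<close>, so \<open>uz01\<close> is not a necklace.
\<close>

section \<open>Comparison decided at a differing letter\<close>

text \<open>Unlike \<open><\<close>, this relation never holds merely because one word is a proper
  prefix of the other, so it survives appending arbitrary words on both sides.\<close>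

definition sless :: "word \<Rightarrow> word \<Rightarrow> bool" (infix "\<prec>" 50) where
  "x \<prec> y \<longleftrightarrow> (\<exists>p u v. x = p @ False # u \<and> y = p @ True # v)"

text \<open>The characterization of Lyndon words by their proper suffixes. Using
  \<open>\<prec>\<close> instead of \<open><\<close> builds in that no proper nonempty suffix is
  also a prefix.\<close>

definition suffix_minimal :: "word \<Rightarrow> bool" where
  "suffix_minimal w \<longleftrightarrow> w \<noteq> [] \<and> (\<forall>x y. w = x @ y \<and> x \<noteq> [] \<and> y \<noteq> [] \<longrightarrow> w \<prec> y)"

abbreviation pow :: "word \<Rightarrow> nat \<Rightarrow> word" where
  "pow t k \<equiv> concat (replicate k t)"

lemma pow_Suc_right: "pow t (Suc k) = pow t k @ t"
  by (induction k) auto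

lemma sless_Nil [simp]: "\<not> [] \<prec> y" "\<not> x \<prec> []"
  by (auto simp: sless_def)

lemma sless_Cons [simp]: "a # x \<prec> b # y \<longleftrightarrow> (\<not> a \<and> b) \<or> (a = b \<and> x \<prec> y)"
proof -
  have "a # x \<prec> b # y \<longleftrightarrow>
    (\<exists>p u v. p = [] \<and> a # x = p @ False # u \<and> b # y = p @ True # v) \<or>
    (\<exists>c q u v. a # x = (c # q) @ False # u \<and> b # y = (c # q) @ True # v)"
    unfolding sless_def by (metis neq_Nil_conv)
  then show ?thesis
    by (auto simp: sless_def)
qed

lemma sless_append_left [simp]: "p @ x \<prec> p @ y \<longleftrightarrow> x \<prec> y"
  by (induction p) auto

lemma sless_append: "x \<prec> y \<Longrightarrow> x @ u \<prec> y @ v"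
  unfolding sless_def by fastforce

lemma sless_append_right1: "x \<prec> y \<Longrightarrow> x @ u \<prec> y"
  using sless_append[of x y u "[]"] by simp

lemma sless_append_right2: "x \<prec> y \<Longrightarrow> x \<prec> y @ v"
  using sless_append[of x y "[]" v] by simp

lemma sless_asym: "x \<prec> y \<Longrightarrow> \<not> y \<prec> x"
proof (induction x arbitrary: y)
  case (Cons a x)
  then show ?case
    by (cases y) auto
qed simp

lemma sless_irrefl [simp]: "\<not> x \<prec> x"
  using sless_asym by blast

lemma sless_imp_not_prefix: "x \<prec> y \<Longrightarrow> \<not> prefix x y" "x \<prec> y \<Longrightarrow> \<not> prefix y x"
  by (auto simp: sless_def prefix_def)

lemma sless_cases:
  obtains "x \<prec> y" | "y \<prec> x" | "prefix x y" | "prefix y x"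
proof -
  have "x \<prec> y \<or> y \<prec> x \<or> prefix x y \<or> prefix y x"
  proof (induction x arbitrary: y)
    case (Cons a x)
    then show ?case
      by (cases y) auto
  qed simp
  then show thesis
    using that by blast
qed

lemma sless_append_cases:
  assumes "x \<prec> y @ z"
  obtains "x \<prec> y" | x' where "x = y @ x'" "x' \<prec> z"
proof (cases rule: sless_cases[of x y])
  case 1
  then show thesis by (rule that(1))
next
  case 2
  then show thesis
    using assms sless_append_right1 sless_asym by blast
next
  case 3
  then show thesis
    using assms sless_imp_not_prefix(1) prefix_order.trans prefix_append by blast
next
  case 4
  then show thesis
    using assms that(2) by (auto simp: prefix_def)
qed

lemma sless_imp_less: "x \<prec> y \<Longrightarrow> x < y"
proof (induction x arbitrary: y)
  case (Cons a x)
  then show ?case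
    by (cases y) auto
qed simp

lemma sless_prefix_trans: "x \<prec> y \<Longrightarrow> prefix y z \<Longrightarrow> x \<prec> z"
  by (auto simp: prefix_def intro: sless_append_right2)

section \<open>Rotations, necklaces and Lyndon words\<close>

lemma rotate_eq_append: "\<exists>x y. w = x @ y \<and> rotate k w = y @ x"
  by (intro exI[of _ "take (k mod length w) w"] exI[of _ "drop (k mod length w) w"])
     (simp add: rotate_drop_take)

lemma necklace_rotation_le:
  assumes "necklace (x @ y)"
  shows "x @ y \<le> y @ x"
proof -
  obtain v C where C: "C = rotation_rel `` {v}" "x @ y \<in> C" "\<forall>u\<in>C. x @ y \<le> u"
    using assms by (auto simp: necklace_def quotient_def)
  have "(x @ y, y @ x) \<in> rotation_rel"
    unfolding rotation_rel_def by (auto intro!: exI[of _ "length x"] simp: rotate_append)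
  then have "y @ x \<in> C"
    using C equiv_rotation_rel by (auto simp: equiv_def elim: transE)
  then show ?thesis
    using C by blast
qed

lemma necklaceI:
  assumes "\<And>k. w \<le> rotate k w"
  shows "necklace w"
  unfolding necklace_def quotient_def
  using assms by (intro bexI[of _ "rotation_rel `` {w}"])
    (auto simp: rotation_rel_def intro: exI[of _ 0])

text \<open>A non-trivial rotation \<open>y @ x\<close> of \<open>x @ y\<close> starts with the
  proper suffix \<open>y\<close>, and the comparison of \<open>w\<close> with it is already decided
  inside \<open>y\<close>.\<close>

lemma suffix_minimal_imp_lyndon:
  assumes "suffix_minimal w"
  shows "lyndon w"
proof -
  have less: "w < y @ x" if "w = x @ y" "x \<noteq> []" "y \<noteq> []" for x y
    using assms that sless_imp_less[OF sless_append_right2] unfolding suffix_minimal_def by blast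
  have "w \<le> rotate k w" for k
    using rotate_eq_append[of w k] less by (metis append.right_neutral append_Nil order.refl order.strict_implies_order)
  moreover have "w < rotate k w" if "0 < k" "k < length w" for k
    using that less[of "take k w" "drop k w"] by (cases "w = []") (auto simp: rotate_drop_take)
  moreover have "w \<noteq> []"
    using assms by (simp add: suffix_minimal_def)
  ultimately show ?thesis
    by (auto simp: lyndon_def intro: necklaceI)
qed

lemma suffix_minimal_no_border:
  assumes "suffix_minimal w" "w = x @ y" "prefix y w"
  shows "x = [] \<or> y = []"
  using assms sless_imp_not_prefix(2) unfolding suffix_minimal_def by blast

section \<open>Lyndon words, their powers and their prefixes\<close>

lemma not_suffix_minimal_pow:
  assumes "t \<noteq> []" "k \<ge> 2"
  shows "\<not> suffix_minimal (pow t k)"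
proof
  assume *: "suffix_minimal (pow t k)"
  obtain j where k: "k = Suc (Suc j)"
    using assms(2) by (metis add_2_eq_Suc le_Suc_ex)
  have "pow t k = pow t (Suc j) @ t"
    unfolding k by (rule pow_Suc_right)
  moreover have "prefix t (pow t k)"
    unfolding k by simp
  ultimately show False
    using suffix_minimal_no_border[OF *, of "pow t (Suc j)" t] assms(1) by simp
qed

lemma append_eq_append_suffix_cases:
  assumes "a @ b = x @ y"
  obtains x' where "a = x @ x'" "y = x' @ b" | x' where "x = a @ x'" "b = x' @ y"
  using assms by (auto simp: append_eq_append_conv2)

text \<open>A suffix that starts strictly inside a copy of \<open>t\<close> is decided there, since
  \<open>t\<close> is below its own proper suffixes. One that starts at a boundary is compared by
  cancelling copies of \<open>t\<close>; the extra factor in \<open>Suc k\<close> leaves a copy to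
  compare with \<open>x\<close>.\<close>

lemma pow_append_sless_suffix:
  assumes t: "suffix_minimal t"
    and x: "\<forall>u e. x = u @ e \<longrightarrow> e \<noteq> [] \<longrightarrow> t \<prec> e" "x \<noteq> []"
    and "pow t k @ x = u @ e" "e \<noteq> []"
  shows "pow t (Suc k) \<prec> e"
  using assms(4,5)
proof (induction k arbitrary: u e)
  case 0
  then show ?case
    using x by simp
next
  case (Suc k)
  then have "t @ (pow t k @ x) = u @ e"
    by simp
  then show ?case
  proof (cases rule: append_eq_append_suffix_cases)
    case (1 g)
    show ?thesis
    proof (cases "u = []")
      case True
      have "pow t (Suc k) \<prec> pow t k @ x"
        using Suc.IH[of "[]" "pow t k @ x"] x(2) by simp
      then show ?thesis
        using 1 True by simp
    next
      case False
      show ?thesis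
      proof (cases "g = []")
        case True
        then have "pow t (Suc k) \<prec> e"
          using Suc.IH[of "[]" e] Suc.prems 1 by simp
        then show ?thesis
          unfolding pow_Suc_right[of "Suc k" t] by (rule sless_append_right1)
      next
        case g: False
        then have "t \<prec> g"
          using t False 1 unfolding suffix_minimal_def by blast
        then show ?thesis
          using sless_append[of t g "pow t (Suc k)" "pow t k @ x"] 1(2) by simp
      qed
    qed
  next
    case (2 x')
    then have "pow t (Suc k) \<prec> e"
      using Suc by blast
    then show ?thesis
      unfolding pow_Suc_right[of "Suc k" t] by (rule sless_append_right1)
  qed
qed

text \<open>After the first \<open>t\<close> is split off, the previous lemma for exponent
  \<open>k - 1\<close> compares suffixes with \<open>pow t k\<close>, which is a prefix of the whole
  word.\<close>

lemma suffix_minimal_pow_append: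
  assumes t: "suffix_minimal t"
    and x: "\<forall>u e. x = u @ e \<longrightarrow> e \<noteq> [] \<longrightarrow> t \<prec> e" "x \<noteq> []"
    and k: "k \<ge> 1"
  shows "suffix_minimal (pow t k @ x)"
  unfolding suffix_minimal_def
proof (intro conjI allI impI)
  show "pow t k @ x \<noteq> []"
    using x by simp
next
  fix u e
  assume *: "pow t k @ x = u @ e \<and> u \<noteq> [] \<and> e \<noteq> []"
  obtain j where j: "k = Suc j"
    using k by (cases k) auto
  from * have "t @ (pow t j @ x) = u @ e"
    by (simp add: j)
  then show "pow t k @ x \<prec> e"
  proof (cases rule: append_eq_append_suffix_cases)
    case (1 g)
    show ?thesis
    proof (cases "g = []")
      case True
      then have "pow t k \<prec> e"
        using pow_append_sless_suffix[OF t x, of j "[]" e] x(2) * 1 unfolding j by simp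
      then show ?thesis
        by (rule sless_append_right1)
    next
      case False
      then have "t \<prec> g"
        using t * 1 unfolding suffix_minimal_def by blast
      then show ?thesis
        using sless_append[of t g "pow t j @ x" "pow t j @ x"] 1(2) by (simp add: j)
    qed
  next
    case (2 x')
    then have "pow t k \<prec> e"
      using pow_append_sless_suffix[OF t x] * unfolding j by blast
    then show ?thesis
      by (rule sless_append_right1)
  qed
qed

text \<open>In \<open>t\<close> the factor \<open>e\<close> is followed by 0, and the suffix
  starting there is \<open>t\<close> itself or above \<open>t\<close>. Raising that 0 to 1 makes the
  comparison strict by the end of \<open>e @ [True]\<close>.\<close>

lemma suffix_minimal_factor_True:
  assumes t: "suffix_minimal t" and "prefix (z @ [False]) t" "z = u @ e"
  shows "t \<prec> e @ [True]"
proof -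
  obtain r where r: "t = u @ e @ False # r"
    using assms by (auto simp: prefix_def)
  show ?thesis
  proof (cases "u = []")
    case True
    then show ?thesis
      by (simp add: r)
  next
    case False
    then have "t \<prec> e @ False # r"
      using t r unfolding suffix_minimal_def by blast
    then show ?thesis
    proof (cases rule: sless_append_cases)
      case 1
      then show ?thesis
        by (rule sless_append_right2)
    next
      case (2 x')
      then show ?thesis
        by (cases x') auto
    qed
  qed
qed

lemma suffix_minimal_sless_True:
  assumes "suffix_minimal t" "prefix (z @ [False]) t"
  shows "t \<prec> True # e"
  using suffix_minimal_factor_True[OF assms, of z "[]"] sless_append_right2 by fastforce

text \<open>Moving the final \<open>x\<close> to the front gives a smaller rotation: after the
  common prefix \<open>x\<close> it continues with \<open>t\<close>, the original with
  \<open>r\<close>, and \<open>t \<prec> r\<close>.\<close>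

lemma not_necklace_pow_append:
  assumes t: "suffix_minimal t" "t = x @ r" "x \<noteq> []" "r \<noteq> []"
  shows "\<not> necklace (pow t (Suc k) @ x)"
proof
  assume "necklace (pow t (Suc k) @ x)"
  then have le: "pow t (Suc k) @ x \<le> x @ pow t (Suc k)"
    by (rule necklace_rotation_le)
  have "t \<prec> r"
    using t unfolding suffix_minimal_def by blast
  then have "pow t (Suc k) \<prec> r @ pow t k @ x"
    by (auto intro: sless_append)
  then have "x @ pow t (Suc k) \<prec> pow t (Suc k) @ x"
    using t(2) by simp
  then show False
    using le sless_imp_less by (meson leD)
qed

section \<open>Decomposing a necklace without its last letter\<close>

lemma necklace_last:
  assumes "necklace w" "True \<in> set w"
  obtains a where "w = a @ [True]"
proof -
  \<comment> \<open>Moving a final 0 to the front gives a smaller rotation unless all letters are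
    0.\<close>
  have *: "True \<notin> set a" if "a @ [False] \<le> False # a" for a
    using that
  proof (induction a)
    case (Cons b a)
    then show ?case
      by (cases b) auto
  qed simp
  obtain a b where w: "w = a @ [b]"
    using assms(2) by (metis empty_iff list.set(1) rev_exhaust)
  have "b"
    using necklace_rotation_le[of a "[b]"] * assms w by (cases b) auto
  then show thesis
    using that w by simp
qed

lemma necklace_butlast_suffix:
  assumes "necklace (a @ [True])" "a = u @ s"
  shows "\<not> s \<prec> a"
proof
  assume "s \<prec> a"
  then have "s @ True # u \<prec> a @ [True]"
    by (rule sless_append)
  then show False
    using necklace_rotation_le[of u "s @ [True]"] assms sless_imp_less leD by fastforce
qed

text \<open>The suffix \<open>s\<close> is taken to be the longest proper border of \<open>a\<close>.\<close>

lemma pow_decomposition: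
  assumes pre: "\<And>u s. a = u @ s \<Longrightarrow> \<not> s \<prec> a" and "a \<noteq> []"
  obtains t s where "a = t @ s" "prefix s a" "suffix_minimal t"
proof -
  define P where "P s \<longleftrightarrow> (\<exists>t. t \<noteq> [] \<and> a = t @ s \<and> prefix s a)" for s
  have "P []"
    using assms(2) by (simp add: P_def)
  moreover have "\<forall>s. P s \<longrightarrow> length s < Suc (length a)"
    by (auto simp: P_def)
  ultimately have "\<exists>s. P s \<and> (\<forall>s'. P s' \<longrightarrow> length s' \<le> length s)"
    by (rule ex_has_greatest_nat[where f = length])
  then obtain s where "P s" and max: "\<And>s'. P s' \<Longrightarrow> length s' \<le> length s"
    by blast
  then obtain t where t: "t \<noteq> []" "a = t @ s" "prefix s a"
    unfolding P_def by blast
  have "t \<prec> y" if y: "t = m @ y" "m \<noteq> []" "y \<noteq> []" for m y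
  proof -
    \<comment> \<open>Otherwise \<open>y @ s\<close> would be a proper border of \<open>a\<close>
      longer than \<open>s\<close>.\<close>
    have "\<not> prefix (y @ s) a"
    proof
      assume "prefix (y @ s) a"
      then have "P (y @ s)"
        unfolding P_def using y t(2) by (intro exI[of _ m]) simp
      then show False
        using max[of "y @ s"] y(3) by simp
    qed
    moreover have "\<not> prefix a (y @ s)"
      using y(1,2) t(2) by (auto dest: prefix_length_le)
    moreover have "\<not> y @ s \<prec> a"
      using pre[of m "y @ s"] y(1) t(2) by simp
    ultimately have "a \<prec> y @ s"
      by (cases rule: sless_cases[of a "y @ s"]) blast+
    \<comment> \<open>Either the first difference lies inside \<open>y\<close>, where
      \<open>a\<close> agrees with \<open>t\<close>, or \<open>a = y @ r\<close> with
      \<open>r \<prec> s\<close>. The latter makes the suffix \<open>r\<close> of \<open>a\<close>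
      smaller than \<open>a\<close>, against \<open>pre\<close>.\<close>
    then show ?thesis
    proof (cases rule: sless_append_cases)
      case 1
      show ?thesis
      proof (cases rule: sless_cases[of t y])
        case 2
        then show ?thesis
          using 1 t sless_append_right2 sless_asym by blast
      next
        case 3
        then show ?thesis
          using y(1,2) by (auto dest: prefix_length_le)
      next
        case 4
        then show ?thesis
          using 1 t sless_imp_not_prefix(2) prefix_order.trans prefixI by blast
      qed
    next
      case (2 r)
      then have "r \<prec> a"
        using t(3) sless_prefix_trans by blast
      then show ?thesis
        using pre 2 by blast
    qed
  qed
  then have "suffix_minimal t"
    using t(1) unfolding suffix_minimal_def by blast
  then show thesis
    using that t by blast
qed

text \<open>The hypothesis says that \<open>s\<close> has period \<open>length t\<close>, so copies
  of \<open>t\<close> can be stripped from its front. Stopping as soon as the rest is a prefix of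
  \<open>t\<close> keeps \<open>t'\<close> nonempty; it may be all of \<open>t\<close>.\<close>

lemma prefix_periodic:
  assumes "prefix s (t @ s)" "t \<noteq> []" "s \<noteq> []"
  obtains k t' where "s = pow t k @ t'" "t' \<noteq> []" "prefix t' t"
  using assms
proof (induction "length s" arbitrary: s thesis rule: less_induct)
  case less
  show ?case
  proof (cases "prefix s t")
    case True
    then show ?thesis
      using less.prems(1)[of 0 s] less.prems by simp
  next
    case False
    then obtain s' where s': "s = t @ s'" "prefix s' s" "s' \<noteq> []"
      using less.prems by (auto simp: prefix_append)
    then obtain k t' where "s' = pow t k @ t'" "t' \<noteq> []" "prefix t' t"
      using less.hyps[of s'] less.prems by auto
    then show ?thesis
      using less.prems(1)[of "Suc k" t'] s' by simp
  qed
qed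

lemma replicate_True_eq_append: "replicate j True = u @ b # e \<Longrightarrow> b"
  by (metis in_set_conv_decomp in_set_replicate)

lemma last_zero_decomposition:
  assumes "False \<in> set x"
  obtains z c where "x = z @ False # replicate c True"
proof -
  obtain z y where "x = z @ False # y" "False \<notin> set y"
    using assms by (meson split_list_last)
  moreover from this have "y = replicate (length y) True"
    by (intro replicate_eqI) (auto, metis (full_types))
  ultimately show thesis
    using that[of z "length y"] by simp
qed

section \<open>The map that shortens a necklace\<close>

text \<open>The three alternatives list what may follow the prefix \<open>z01^c\<close> in
  \<open>t\<close>; they later determine \<open>c\<close>. In the last one
  \<open>pow t k @ z @ False # replicate c True @ [True]\<close> is the periodic word
  \<open>pow t (Suc k)\<close>.\<close>

definition lyndon_power_form :: "word \<Rightarrow> nat \<Rightarrow> word \<Rightarrow> nat \<Rightarrow> bool" where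
  "lyndon_power_form t k z c \<longleftrightarrow> suffix_minimal t \<and> k \<ge> 1 \<and>
     (t = z @ False # replicate c True \<or>
      prefix (z @ False # replicate c True @ [False]) t \<or>
      t = z @ False # replicate c True @ [True])"

text \<open>A relation, so that no decomposition of \<open>w\<close> has to be singled out:
  injectivity is proved for all related pairs, hence for every choice of images.\<close>

definition shrink :: "word \<Rightarrow> word \<Rightarrow> bool" where
  "shrink w y \<longleftrightarrow> necklace w \<and> (\<exists>t k z c. lyndon_power_form t k z c \<and>
     w = pow t k @ z @ False # replicate c True @ [True] \<and>
     y = pow t k @ replicate c True @ z @ [True])"

lemma lyndon_power_form_prefix:
  "lyndon_power_form t k z c \<Longrightarrow> prefix (z @ False # replicate c True) t"
  unfolding lyndon_power_form_def
  by (auto simp: prefix_def)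

lemma lyndon_power_form_prefix_False:
  "lyndon_power_form t k z c \<Longrightarrow> prefix (z @ [False]) t"
  by (auto dest!: lyndon_power_form_prefix simp: prefix_def)

lemma shrink_exists:
  assumes w: "necklace (a @ [True])" and "\<not> lyndon a" "False \<in> set a"
  obtains y where "shrink (a @ [True]) y"
proof -
  have "a \<noteq> []"
    using assms by auto
  then obtain t s where t: "a = t @ s" "prefix s a" "suffix_minimal t"
    using pow_decomposition[of a] necklace_butlast_suffix[OF w] by blast
  moreover have "s \<noteq> []"
    using t assms suffix_minimal_imp_lyndon by auto
  moreover have "t \<noteq> []"
    using t(3) by (simp add: suffix_minimal_def)
  ultimately obtain k t' where t': "s = pow t k @ t'" "t' \<noteq> []" "prefix t' t"
    using prefix_periodic by metis
  have a: "a = pow t (Suc k) @ t'"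
    using t t' by simp
  have "False \<in> set t"
    using assms(3) t'(3) unfolding a by (auto dest: set_mono_prefix)
  then obtain p q where pq: "t = p @ False # q"
    by (meson split_list)
  \<comment> \<open>This forces \<open>t\<close>, and with it the nonempty prefix \<open>t'\<close>,
    to start with 0, so \<open>t'\<close> has a last 0 at which to cut.\<close>
  have "t \<prec> True # tl t"
    using suffix_minimal_sless_True[OF t(3), of p] pq by (simp add: prefix_def)
  then have "\<not> hd t'"
    using t'(2,3) by (cases t') (auto simp: prefix_def)
  then have "False \<in> set t'"
    using t'(2) by (metis (full_types) list.set_sel(1))
  then obtain z c where z: "t' = z @ False # replicate c True"
    by (rule last_zero_decomposition)
  obtain r where r: "t = t' @ r"
    using t'(3) by (auto simp: prefix_def)
  \<comment> \<open>If 1 and at least one further letter followed \<open>t'\<close> in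
    \<open>t\<close>, then \<open>t' @ [True]\<close> would be a proper prefix of \<open>t\<close>,
    and \<open>a @ [True]\<close> would not be a necklace.\<close>
  have "r = [] \<or> \<not> hd r \<or> r = [True]"
  proof (rule ccontr)
    assume "\<not> ?thesis"
    then obtain r' where "r = True # r'" "r' \<noteq> []"
      by (cases r) auto
    then have "t = (t' @ [True]) @ r'" "r' \<noteq> []"
      using r by simp_all
    then have "\<not> necklace (pow t (Suc k) @ t' @ [True])"
      using not_necklace_pow_append[OF t(3)] by blast
    then show False
      using w a by simp
  qed
  then have "lyndon_power_form t (Suc k) z c"
    unfolding lyndon_power_form_def using t(3) r z
    by (cases r) simp_all
  moreover have "a @ [True] = pow t (Suc k) @ z @ False # replicate c True @ [True]"
    unfolding a z by simp
  ultimately show thesis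
    using that[of "pow t (Suc k) @ replicate c True @ z @ [True]"] w unfolding shrink_def by blast
qed

lemma shrink_lyndon:
  assumes "shrink w y"
  shows "lyndon y"
proof -
  obtain t k z c where f: "lyndon_power_form t k z c" and
    y: "y = pow t k @ replicate c True @ z @ [True]"
    using assms by (auto simp: shrink_def)
  have t: "suffix_minimal t" "k \<ge> 1"
    using f by (auto simp: lyndon_power_form_def)
  note zF = lyndon_power_form_prefix_False[OF f]
  \<comment> \<open>Suffixes starting in the block of ones exceed \<open>t\<close> because
    \<open>t\<close> starts with 0; those starting in \<open>z @ [True]\<close> do so because
    \<open>z\<close> is followed by 0 in \<open>t\<close>.\<close>
  have "t \<prec> e" if "replicate c True @ z @ [True] = u @ e" and e: "e \<noteq> []" for u e
    using that(1)
  proof (cases rule: append_eq_append_suffix_cases)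
    case (1 g)
    show ?thesis
    proof (cases g)
      case Nil
      then show ?thesis
        using 1 suffix_minimal_factor_True[OF t(1) zF, of "[]"] by simp
    next
      case (Cons b g')
      then have b
        using 1 replicate_True_eq_append by blast
      then show ?thesis
        using 1 Cons suffix_minimal_sless_True[OF t(1) zF] by simp
    qed
  next
    case (2 x')
    then obtain e' where "e = e' @ [True]" "z = x' @ e'"
      using e by (cases e rule: rev_cases) auto
    then show ?thesis
      using suffix_minimal_factor_True[OF t(1) zF] by blast
  qed
  then show ?thesis
    unfolding y using t by (intro suffix_minimal_imp_lyndon suffix_minimal_pow_append) auto
qed

lemma shrink_length: "shrink w y \<Longrightarrow> length w = Suc (length y)"
  by (auto simp: shrink_def)

lemma shrink_density: "shrink w y \<Longrightarrow> density w = density y"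
  by (auto simp: shrink_def density_def)

section \<open>Recovering the necklace from its image\<close>

lemma suffix_minimal_pow_ones:
  assumes "lyndon_power_form t k z c" "j \<ge> 1"
  shows "suffix_minimal (pow t k @ replicate j True)"
proof (rule suffix_minimal_pow_append)
  show "suffix_minimal t" "k \<ge> 1" "replicate j True \<noteq> []"
    using assms by (auto simp: lyndon_power_form_def)
  show "\<forall>u e. replicate j True = u @ e \<longrightarrow> e \<noteq> [] \<longrightarrow> t \<prec> e"
  proof (intro allI impI)
    fix u e
    assume that: "replicate j True = u @ e" and "e \<noteq> []"
    obtain b e' where e: "e = b # e'"
      using \<open>e \<noteq> []\<close> by (cases e) auto
    have b
      using that replicate_True_eq_append unfolding e by blast
    then show "t \<prec> e"
      using e suffix_minimal_sless_True[OF _ lyndon_power_form_prefix_False[OF assms(1)]] assms(1)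
      by (simp add: lyndon_power_form_def)
  qed
qed

text \<open>If one of \<open>u\<close>, \<open>u'\<close> were longer, its excess \<open>g\<close>
  would be a prefix of the other word's remainder, hence of the shorter word, hence a border of the
  longer one.\<close>

lemma suffix_minimal_prefix_unique:
  assumes "suffix_minimal u" "suffix_minimal u'" "u @ z = u' @ z'" "prefix z u" "prefix z' u'"
  shows "u = u'"
  using assms(3)
proof (cases rule: append_eq_append_suffix_cases)
  case (1 g)
  then have "prefix g u"
    using assms(5) by (metis append_prefixD prefix_append prefix_order.trans prefixI)
  then show ?thesis
    using suffix_minimal_no_border[OF assms(1) 1(1)] assms(2) 1 by (auto simp: suffix_minimal_def)
next
  case (2 g)
  then have "prefix g u'"
    using assms(4) by (metis append_prefixD prefix_append prefix_order.trans prefixI)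
  then show ?thesis
    using suffix_minimal_no_border[OF assms(2) 2(1)] assms(1) 2 by (auto simp: suffix_minimal_def)
qed

lemma lyndon_power_form_proper_prefix:
  assumes f: "lyndon_power_form t k z c" and "c \<ge> 1"
  obtains r where "pow t k @ replicate c True = (z @ [False, True]) @ r" "r \<noteq> []"
proof -
  obtain j where k: "k = Suc j"
    using f by (cases k) (auto simp: lyndon_power_form_def)
  obtain i where c: "c = Suc i"
    using assms(2) by (cases c) auto
  obtain r where "t = z @ False # replicate c True @ r"
    using lyndon_power_form_prefix[OF f] by (auto simp: prefix_def)
  then have "pow t k @ replicate c True =
      (z @ [False, True]) @ replicate i True @ r @ pow t j @ replicate c True"
    by (simp add: k c)
  then show thesis
    by (rule that) (simp add: c)
qed

text \<open>If \<open>c' > c\<close>, cancelling \<open>c\<close> ones on the right makes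
  \<open>pow t k\<close> a Lyndon word ending in surplus ones. Then \<open>k = 1\<close>, and
  \<open>t\<close> itself begins with \<open>z01^c'\<close>.\<close>

lemma lyndon_power_form_exponent_le:
  assumes f: "lyndon_power_form t k z c" and f': "lyndon_power_form t' k' z c'"
    and eq: "pow t k @ replicate c True = pow t' k' @ replicate c' True"
  shows "c' \<le> c"
proof (rule ccontr)
  assume "\<not> c' \<le> c"
  then obtain j where c': "c' = c + Suc j"
    using less_imp_Suc_add by fastforce
  have "replicate c' True = replicate (Suc j) True @ replicate c True"
    unfolding c' by (metis add.commute replicate_add)
  then have eq': "pow t k = pow t' k' @ replicate (Suc j) True"
    using eq by simp
  then have "suffix_minimal (pow t k)"
    using suffix_minimal_pow_ones[OF f', of "Suc j"] by simp
  moreover have "t \<noteq> []" "k \<ge> 1"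
    using f by (auto simp: lyndon_power_form_def suffix_minimal_def)
  ultimately have "k = 1"
    using not_suffix_minimal_pow[of t k] by linarith
  obtain i where k': "k' = Suc i"
    using f' by (cases k') (auto simp: lyndon_power_form_def)
  obtain r where "t' = z @ False # replicate c' True @ r"
    using lyndon_power_form_prefix[OF f'] by (auto simp: prefix_def)
  \<comment> \<open>Here \<open>z01^c\<close> is followed by 1, and the nonempty final block of ones
    shows that this 1 does not end \<open>t\<close>. All three alternatives fail.\<close>
  then have t: "t = z @ False # replicate c True @ True # replicate j True @ r @ pow t' i @ replicate (Suc j) True"
    using eq' \<open>k = 1\<close> by (simp add: k' c' replicate_add replicate_append_same replicate_app_Cons_same)
  have "t = z @ False # replicate c True \<or>
      prefix (z @ False # replicate c True @ [False]) t \<or>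
      t = z @ False # replicate c True @ [True]"
    using f by (simp add: lyndon_power_form_def)
  then show False
    unfolding t by (auto simp: prefix_def)
qed

lemma shrink_inj:
  assumes "shrink w y" "shrink w' y"
  shows "w = w'"
proof -
  have no_mix: False
    if f: "lyndon_power_form t k z c" "lyndon_power_form t' k' z' c'" "c = 0" "c' \<ge> 1"
      and w: "necklace (pow t k @ z @ False # replicate c True @ [True])"
      and y: "pow t k @ replicate c True @ z @ [True] = pow t' k' @ replicate c' True @ z' @ [True]"
    for t k z c t' k' z' c'
  proof -
    let ?u = "pow t' k' @ replicate c' True"
    obtain r where r: "?u = (z' @ [False, True]) @ r" "r \<noteq> []"
      using lyndon_power_form_proper_prefix f by blast
    \<comment> \<open>With \<open>c = 0\<close>, equality of the images turns the necklace
      \<open>pow t k @ z @ [False, True]\<close> into \<open>?u @ z' @ [False, True]\<close>: a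
      Lyndon word followed by a proper prefix of itself.\<close>
    have "\<not> necklace (pow ?u (Suc 0) @ z' @ [False, True])"
      using not_necklace_pow_append[OF suffix_minimal_pow_ones[OF f(2,4)] r(1) _ r(2)] by blast
    moreover have "pow t k @ z = ?u @ z'"
      using y \<open>c = 0\<close> by (simp flip: append_assoc)
    ultimately show False
      using w \<open>c = 0\<close> by (simp flip: append_assoc)
  qed
  obtain t k z c where f: "lyndon_power_form t k z c" "necklace w"
    "w = pow t k @ z @ False # replicate c True @ [True]"
    "y = pow t k @ replicate c True @ z @ [True]"
    using assms(1) by (auto simp: shrink_def)
  obtain t' k' z' c' where f': "lyndon_power_form t' k' z' c'" "necklace w'"
    "w' = pow t' k' @ z' @ False # replicate c' True @ [True]"
    "y = pow t' k' @ replicate c' True @ z' @ [True]"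
    using assms(2) by (auto simp: shrink_def)
  let ?u = "pow t k @ replicate c True" and ?u' = "pow t' k' @ replicate c' True"
  have eq: "?u @ z = ?u' @ z'"
    using f(4) f'(4) by (simp flip: append_assoc)
  consider "c = 0" "c' = 0" | "c \<ge> 1" "c' \<ge> 1"
    using no_mix[OF f(1) f'(1)] no_mix[OF f'(1) f(1)] f f' by fastforce
  then show ?thesis
  proof cases
    case 1
    then show ?thesis
      using eq f(3) f'(3) by (simp flip: append_assoc)
  next
    case 2
    have "prefix z ?u" "prefix z' ?u'"
      using lyndon_power_form_proper_prefix f(1) f'(1) 2 by (metis append_assoc prefixI)+
    then have u: "?u = ?u'"
      using eq by (intro suffix_minimal_prefix_unique[OF suffix_minimal_pow_ones[OF f(1) 2(1)] suffix_minimal_pow_ones[OF f'(1) 2(2)]])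
    then have z: "z = z'"
      using eq by simp
    have "c = c'"
      using lyndon_power_form_exponent_le[of t k z c t' k' c'] lyndon_power_form_exponent_le[of t' k' z c' t k c]
        f(1) f'(1) u z by simp
    then show ?thesis
      using u z f(3) f'(3) by simp
  qed
qed

section \<open>Counting\<close>

lemma finite_words: "finite {w :: word. length w = n \<and> P w}"
  using finite_lists_length_eq[of "UNIV :: bool set" n] by (rule finite_subset[rotated]) auto

theorem theorem1p1:
  fixes n d :: nat
  assumes "0 < d" and "d < n"
  shows "num_necklaces n d \<le> num_lyndon (n - 1) d + num_lyndon (n - 1) (d - 1)"
proof -
  let ?N = "{w. length w = n \<and> density w = d \<and> necklace w}"
  let ?L = "\<lambda>e. {w. length w = n - 1 \<and> density w = e \<and> lyndon w}"
  \<comment> \<open>On \<open>?G\<close> deleting the final 1 lowers the density to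
    \<open>d - 1\<close>; on \<open>?B\<close> one letter 0 is lost and the density stays
    \<open>d\<close>.\<close>
  let ?G = "{w \<in> ?N. lyndon (butlast w)}" and ?B = "{w \<in> ?N. \<not> lyndon (butlast w)}"
  \<comment> \<open>\<open>0 < d\<close> supplies a 1, so the necklace ends in 1;
    \<open>d < n\<close> supplies a 0, which must lie before that last letter.\<close>
  have ends: "\<exists>a. w = a @ [True] \<and> False \<in> set a" if w: "w \<in> ?N" for w
  proof -
    have "True \<in> set w"
      using w assms(1) count_notin[of True w] by (auto simp: density_def)
    then obtain a where a: "w = a @ [True]"
      using necklace_last w by blast
    have "False \<in> set a"
    proof (rule ccontr)
      assume "False \<notin> set a"
      then have "filter ((=) True) a = a"
        by (intro filter_True) (metis (full_types))
      then show False
        using w assms(2) a by (simp add: density_def count_list_eq_length_filter)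
    qed
    then show ?thesis
      using a by blast
  qed
  have good: "w = butlast w @ [True]" if w: "w \<in> ?G" for w
  proof -
    obtain a where "w = a @ [True]"
      using ends[of w] w by blast
    then show ?thesis
      by simp
  qed
  have "card ?G \<le> card (?L (d - 1))"
  proof (rule card_inj_on_le)
    show "inj_on butlast ?G"
    proof (rule inj_onI)
      fix w w'
      assume w: "w \<in> ?G" "w' \<in> ?G" and eq: "butlast w = butlast w'"
      have "w = butlast w @ [True]"
        using w(1) by (rule good)
      also have "\<dots> = w'"
        unfolding eq using w(2) by (rule good[symmetric])
      finally show "w = w'" .
    qed
    show "butlast ` ?G \<subseteq> ?L (d - 1)"
    proof (rule image_subsetI)
      fix w
      assume w: "w \<in> ?G"
      have "density w = Suc (density (butlast w))"
        by (subst good[OF w]) (simp add: density_def)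
      moreover have "density w = d"
        using w by simp
      ultimately have "density (butlast w) = d - 1"
        by linarith
      then show "butlast w \<in> ?L (d - 1)"
        using w by simp
    qed
  qed (rule finite_words)
  moreover have "card ?B \<le> card (?L d)"
  proof -
    have "\<exists>y. shrink w y" if w: "w \<in> ?B" for w
    proof -
      obtain a where a: "w = a @ [True]" "False \<in> set a"
        using ends[of w] w by blast
      have "necklace (a @ [True])" "\<not> lyndon a"
        using w unfolding a(1) by simp_all
      then obtain y where "shrink (a @ [True]) y"
        using a(2) by (rule shrink_exists)
      then show ?thesis
        unfolding a(1) by blast
    qed
    then have "\<forall>w\<in>?B. \<exists>y. shrink w y"
      by (rule ballI)
    then obtain f where f: "\<And>w. w \<in> ?B \<Longrightarrow> shrink w (f w)"
      unfolding bchoice_iff by blast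
    show ?thesis
    proof (rule card_inj_on_le)
      show "inj_on f ?B"
      proof (rule inj_onI)
        fix w w'
        assume "w \<in> ?B" "w' \<in> ?B" "f w = f w'"
        then show "w = w'"
          using f[of w] f[of w'] shrink_inj[of w "f w" w'] by simp
      qed
      show "f ` ?B \<subseteq> ?L d"
      proof (rule image_subsetI)
        fix w
        assume w: "w \<in> ?B"
        then show "f w \<in> ?L d"
          using shrink_length[OF f[OF w]] shrink_density[OF f[OF w]] shrink_lyndon[OF f[OF w]] by auto
      qed
    qed (rule finite_words)
  qed
  moreover have "card ?N \<le> card ?G + card ?B"
  proof -
    have "?G \<union> ?B = ?N"
      by blast
    then show ?thesis
      using card_Un_le[of ?G ?B] by (simp only:)
  qed
  ultimately show ?thesis
    by (simp add: num_necklaces_def num_lyndon_def)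
qed

end
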